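(* Let $m \geq 1$ be an integer and let $i : \mathbb{N} \rightarrow \{1, 2, \dots, m\}$ be a random mapping, i.e. every $j \in \{1,\dots,m\}$ satisfies $i(k) = j$ for infinitely many $k \in \mathbb{N}$. Then there exists a monotonically increasing sequence $\{\tau_k\}_{k \geq 0} \subset \mathbb{N}$ such that $i$ is a control with respect to $\{\tau_k\}_{k\ge 0}$, i.e. for all $k \geq 0$, $$\{1, 2, \dots, m\} \subseteq \{i(\tau_k), i(\tau_k + 1), \dots, i(\tau_{k+1} - 1)\}.$$
   Context: $\mathbb{N} = \{0,1,2,\dots\}$. "Monotonically increasing" means $\tau_{k+1} > \tau_k$ for all $k \geq 0$. Definition (control): given a monotonically increasing sequence $\{\tau_k\}_{k\ge 0} \subset \mathbb{N}$, a mapping $i : \mathbb{N} \to \{1,\dots,m\}$ is called a control with respect to $\{\tau_k\}_{k \geq 0}$ if for all $k \geq 0$, $\{1,\dots,m\} \subseteq \{i(\tau_k), i(\tau_k+1), \dots, i(\tau_{k+1}-1)\}$. Definition (random mapping): a mapping $i : \mathbb{N} \to \{1,\dots,m\}$ is called a random mapping if every $j \in \{1,\dots,m\}$ appears infinitely many times among the values $i(k)$, $k \geq 0$ (a deterministic notion; no probability is involved). *)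

theory Defs
  imports Main
begin

definition random_mapping :: "nat \<Rightarrow> (nat \<Rightarrow> nat) \<Rightarrow> bool" where
  "random_mapping m i \<longleftrightarrow>
     range i \<subseteq> {1..m} \<and> (\<forall>j\<in>{1..m}. infinite {k. i k = j})"

(* The notion is used only for strictly increasing \<tau>; that requirement on \<tau> is
   stated separately wherever the notion is used. *)
definition control :: "nat \<Rightarrow> (nat \<Rightarrow> nat) \<Rightarrow> (nat \<Rightarrow> nat) \<Rightarrow> bool" where
  "control m \<tau> i \<longleftrightarrow>
     range i \<subseteq> {1..m} \<and> (\<forall>k. {1..m} \<subseteq> i ` {\<tau> k..<\<tau> (Suc k)})"

end

theory Submission
  imports Defs "HOL-Library.Infinite_Set"
begin

text \<open>Since each of the finitely many values recurs infinitely often, past any time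
  \<open>t\<close> each has a later occurrence, and a window starting at \<open>t\<close> that
  reaches the latest of these contains all values (\<open>random_mapping_covering_interval\<close>).
  Chaining such windows end to end yields \<tau>.\<close>

lemma random_mapping_covering_interval:
  assumes "random_mapping m i"
  shows "\<exists>u>t. {1..m} \<subseteq> i ` {t..<u}"
proof -
  have "\<exists>k\<ge>t. i k = j" if "j \<in> {1..m}" for j
    using assms that by (auto simp: random_mapping_def infinite_nat_iff_unbounded_le)
  then obtain f where f: "\<And>j. j \<in> {1..m} \<Longrightarrow> f j \<ge> t \<and> i (f j) = j"
    by metis
  \<comment> \<open>\<open>Suc\<close> is there because the window excludes its right end; inserting
    \<open>t\<close> gives \<open>t < u\<close> directly from the maximum.\<close>
  define u where "u = Suc (Max (insert t (f ` {1..m})))"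
  have less: "f j < u" if "j \<in> {1..m}" for j
    using that unfolding u_def less_Suc_eq_le by (intro Max_ge) simp_all
  have "t < u"
    unfolding u_def less_Suc_eq_le by (intro Max_ge) simp_all
  moreover have "{1..m} \<subseteq> i ` {t..<u}"
  proof
    fix j assume "j \<in> {1..m}"
    with f less have "f j \<in> {t..<u}" "j = i (f j)"
      by auto
    then show "j \<in> i ` {t..<u}"
      by blast
  qed
  ultimately show ?thesis
    by blast
qed

theorem proposition1:
  fixes m :: nat and i :: "nat \<Rightarrow> nat"
  assumes "m \<ge> 1" and "random_mapping m i"
  shows "\<exists>\<tau> :: nat \<Rightarrow> nat. strict_mono \<tau> \<and> control m \<tau> i"
proof -
  \<comment> \<open>Dependent choice: each window's end serves as the start of the next. The state
    predicate is trivial because a covering window exists from every \<open>t\<close>, so the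
    initial time is arbitrary.\<close>
  obtain \<tau> :: "nat \<Rightarrow> nat"
    where \<tau>: "\<And>k. \<tau> k < \<tau> (Suc k) \<and> {1..m} \<subseteq> i ` {\<tau> k..<\<tau> (Suc k)}"
    using dependent_nat_choice[of "\<lambda>_ _. True" "\<lambda>_ t u. t < u \<and> {1..m} \<subseteq> i ` {t..<u}"]
      random_mapping_covering_interval[OF assms(2)]
    by auto
  then have "strict_mono \<tau>"
    by (simp add: strict_mono_Suc_iff)
  moreover have "control m \<tau> i"
    using assms(2) \<tau> by (simp add: control_def random_mapping_def)
  ultimately show ?thesis
    by blast
qed

end
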